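(* Let $p,q>0$, $r,t\ge0$. Assume that $\Psi_{p,q;r,t}$ is positive and $r^2+t^2>pq$. Then $r,t>0$, and the normalized operator \[ \widehat\rho_{p,r,t}=\frac{\rho_{p,r,t}}{\operatorname{Tr}\rho_{p,r,t}} \] is a PPT entangled state satisfying \[ \operatorname{rank}\widehat\rho_{p,r,t}=\operatorname{rank}\widehat\rho_{p,r,t}^{\,\Gamma}=5,\qquad \operatorname{SN}(\widehat\rho_{p,r,t})=\operatorname{SN}(\widehat\rho_{p,r,t}^{\,\Gamma})=2 . \] In particular the region $\{r^2\le pq,\ t^2\le pq,\ r^2+t^2>pq\}$, on which $\Psi_{p,q;r,t}$ is atomic, carries an explicit family of PPT entangled states of birank $(5,5)$ with Schmidt numbers $(2,2)$ for the state and its partial transpose. If $p,r,t$ are rational, then $\widehat\rho_{p,r,t}$ has rational matrix entries.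
   Context: For $p,q>0$, $r,t\ge0$, $\Psi_{p,q;r,t}:M_3(\mathbb C)\to M_3(\mathbb C)$ is \[ \Psi_{p,q;r,t}(X)=\begin{pmatrix} p(x_{11}+x_{22})&0&r x_{13}\\ 0&p(x_{11}+x_{22})&t x_{32}\\ r x_{31}&t x_{23}&q x_{33}\end{pmatrix}. \] Positive means preserving positive semidefiniteness. A positive map is atomic if it is not a sum of a $2$-positive and a $2$-copositive map ($\Phi$ is $k$-copositive if its composition with the transposition, $\mathsf T\circ\Phi$, is $k$-positive). Let $f_{ij}=e_i\otimes e_j\in\mathbb C^3\otimes\mathbb C^3$, $\alpha=r/p$, $\beta=t/p$, and \begin{align*} \rho_{p,r,t}={}&|\alpha f_{11}-f_{33}\rangle\langle\alpha f_{11}-f_{33}|+\beta|f_{23}-f_{32}\rangle\langle f_{23}-f_{32}|\\ &+\alpha\bigl(|f_{13}\rangle\langle f_{13}|+|f_{31}\rangle\langle f_{31}|\bigr)+\beta^2|f_{22}\rangle\langle f_{22}|. \end{align*} $\Gamma=\operatorname{id}\otimes\mathsf T$ is partial transposition on the second tensor factor in the standard basis. A state (positive semidefinite, trace one) is PPT if its partial transpose is positive semidefinite; it is entangled if it is not separable (not a convex combination of product states). The birank is the pair $(\operatorname{rank}\rho,\operatorname{rank}\rho^\Gamma)$. $\operatorname{SN}(\rho)$ is the Schmidt number: the least $k$ such that $\rho$ is a sum of operators $|v\rangle\langle v|$ with each $v$ of Schmidt rank at most $k$. *)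

theory Defs
  imports "HOL-Analysis.Analysis"
begin

type_synonym 'n cmat = "complex^'n^'n"

definition mscale :: "complex \<Rightarrow> ('n::finite) cmat \<Rightarrow> 'n cmat"
  where "mscale c A = (\<chi> i j. c * A $ i $ j)"

(* Over the complex numbers, a quadratic form with values in [0,\<infinity>) forces A to be Hermitian. *)
definition psd :: "('n::finite) cmat \<Rightarrow> bool"
  where "psd A \<longleftrightarrow> (\<forall>v. (\<Sum>i\<in>UNIV. \<Sum>j\<in>UNIV. cnj (v $ i) * A $ i $ j * v $ j) \<in> \<real>\<^sub>\<ge>\<^sub>0)"

text \<open>Positivity of maps between matrix algebras. The tensor product of the spaces with
  bases indexed by \<open>'a\<close> and \<open>'b\<close> is the space with basis indexed by
  \<open>'a \<times> 'b\<close>.\<close>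

definition positive_map :: "(('m::finite) cmat \<Rightarrow> ('n::finite) cmat) \<Rightarrow> bool"
  where "positive_map \<Phi> \<longleftrightarrow>
    Vector_Spaces.linear mscale mscale \<Phi> \<and> (\<forall>X. psd X \<longrightarrow> psd (\<Phi> X))"

(* id \<otimes> \<Phi>: apply \<Phi> to each of the blocks indexed by pairs (a, b). *)
definition ampliation ::
  "(('m::finite) cmat \<Rightarrow> ('n::finite) cmat) \<Rightarrow> ('k::finite \<times> 'm) cmat \<Rightarrow> ('k \<times> 'n) cmat"
  where "ampliation \<Phi> X =
    (\<chi> u v. \<Phi> (\<chi> i j. X $ (fst u, i) $ (fst v, j)) $ snd u $ snd v)"

(* k is the cardinality of the index type 'k. *)
definition k_positive :: "('k::finite) itself \<Rightarrow> (('m::finite) cmat \<Rightarrow> ('n::finite) cmat) \<Rightarrow> bool"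
  where "k_positive _ \<Phi> \<longleftrightarrow> Vector_Spaces.linear mscale mscale \<Phi> \<and>
    positive_map (ampliation \<Phi> :: ('k \<times> 'm) cmat \<Rightarrow> ('k \<times> 'n) cmat)"

definition k_copositive :: "('k::finite) itself \<Rightarrow> (('m::finite) cmat \<Rightarrow> ('n::finite) cmat) \<Rightarrow> bool"
  where "k_copositive k \<Phi> \<longleftrightarrow> k_positive k (transpose \<circ> \<Phi>)"

definition atomic_map :: "(('m::finite) cmat \<Rightarrow> ('n::finite) cmat) \<Rightarrow> bool"
  where "atomic_map \<Phi> \<longleftrightarrow> positive_map \<Phi> \<and>
    \<not> (\<exists>\<Phi>\<^sub>1 \<Phi>\<^sub>2. k_positive TYPE(2) \<Phi>\<^sub>1 \<and> k_copositive TYPE(2) \<Phi>\<^sub>2 \<and>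
          (\<forall>X. \<Phi> X = \<Phi>\<^sub>1 X + \<Phi>\<^sub>2 X))"

definition vtensor :: "complex^('a::finite) \<Rightarrow> complex^('b::finite) \<Rightarrow> complex^('a \<times> 'b)"
  where "vtensor x y = (\<chi> u. x $ fst u * y $ snd u)"

definition mtensor :: "('a::finite) cmat \<Rightarrow> ('b::finite) cmat \<Rightarrow> ('a \<times> 'b) cmat"
  where "mtensor A B = (\<chi> u v. A $ fst u $ fst v * B $ snd u $ snd v)"

(* |x><x| *)
definition ketbra :: "complex^('n::finite) \<Rightarrow> 'n cmat"
  where "ketbra x = (\<chi> i j. x $ i * cnj (x $ j))"

definition partial_transpose :: "('a::finite \<times> 'b::finite) cmat \<Rightarrow> ('a \<times> 'b) cmat"
  where "partial_transpose \<rho> = (\<chi> u v. \<rho> $ (fst u, snd v) $ (fst v, snd u))"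

definition is_state :: "('n::finite) cmat \<Rightarrow> bool"
  where "is_state \<rho> \<longleftrightarrow> psd \<rho> \<and> trace \<rho> = 1"

definition ppt_state :: "('a::finite \<times> 'b::finite) cmat \<Rightarrow> bool"
  where "ppt_state \<rho> \<longleftrightarrow> is_state \<rho> \<and> psd (partial_transpose \<rho>)"

definition separable_state :: "('a::finite \<times> 'b::finite) cmat \<Rightarrow> bool"
  where "separable_state \<rho> \<longleftrightarrow> \<rho> \<in> convex hull {mtensor A B |A B. is_state A \<and> is_state B}"

definition entangled_state :: "('a::finite \<times> 'b::finite) cmat \<Rightarrow> bool"
  where "entangled_state \<rho> \<longleftrightarrow> is_state \<rho> \<and> \<not> separable_state \<rho>"

definition birank :: "('a::finite \<times> 'b::finite) cmat \<Rightarrow> nat \<times> nat"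
  where "birank \<rho> = (rank \<rho>, rank (partial_transpose \<rho>))"

(* The rank of the coefficient matrix of v, i.e. the number of nonzero Schmidt coefficients. *)
definition schmidt_rank :: "complex^('a::finite \<times> 'b::finite) \<Rightarrow> nat"
  where "schmidt_rank v = rank (\<chi> i j. v $ (i, j))"

(* Meaningful only for positive semidefinite \<rho>; otherwise no such decomposition exists. *)
definition schmidt_number :: "('a::finite \<times> 'b::finite) cmat \<Rightarrow> nat"
  where "schmidt_number \<rho> =
    (LEAST k. \<exists>(n::nat) v. (\<forall>i<n. schmidt_rank (v i) \<le> k) \<and> \<rho> = (\<Sum>i<n. ketbra (v i)))"

definition Psi :: "real \<Rightarrow> real \<Rightarrow> real \<Rightarrow> real \<Rightarrow> 3 cmat \<Rightarrow> 3 cmat"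
  where "Psi p q r t X = vector [
    vector [p * (X$1$1 + X$2$2), 0,                   r * X$1$3],
    vector [0,                   p * (X$1$1 + X$2$2), t * X$3$2],
    vector [r * X$3$1,           t * X$2$3,           q * X$3$3]]"

definition fvec :: "3 \<Rightarrow> 3 \<Rightarrow> complex^(3 \<times> 3)"
  where "fvec i j = vtensor (axis i 1) (axis j 1)"

definition rho :: "real \<Rightarrow> real \<Rightarrow> real \<Rightarrow> (3 \<times> 3) cmat"
  where "rho p r t = (let \<alpha> = r / p; \<beta> = t / p in
    ketbra (\<alpha> *\<^sub>R fvec 1 1 - fvec 3 3) + \<beta> *\<^sub>R ketbra (fvec 2 3 - fvec 3 2)
    + \<alpha> *\<^sub>R (ketbra (fvec 1 3) + ketbra (fvec 3 1)) + \<beta>\<^sup>2 *\<^sub>R ketbra (fvec 2 2))"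

definition rho_hat :: "real \<Rightarrow> real \<Rightarrow> real \<Rightarrow> (3 \<times> 3) cmat"
  where "rho_hat p r t = mscale (1 / trace (rho p r t)) (rho p r t)"

end

theory Submission
  imports Defs
begin

text \<open>
  A linear map \<open>\<Phi>\<close> and a bipartite matrix \<open>\<rho>\<close> are paired by the trace of the product of \<open>\<rho>\<close> with
  the Choi matrix of \<open>\<Phi>\<close>. The whole result rests on two facts about this pairing. It is
  nonnegative if \<open>\<Phi>\<close> is \<open>k\<close>-positive and \<open>\<rho>\<close> is a sum of matrices \<open>ketbra v\<close> with \<open>v\<close> of Schmidt
  rank at most \<open>k\<close> (\<open>pairing_nonneg\<close>), and for \<open>Psi\<close> and \<open>rho\<close> it equals \<open>q - (r\<^sup>2 + t\<^sup>2) / p\<close>, which is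
  negative under the assumption \<open>r\<^sup>2 + t\<^sup>2 > p q\<close> (\<open>pairing_Psi_rho\<close>).

  By its definition \<open>rho\<close> is a nonnegative combination of such matrices with \<open>k = 2\<close>, and so is its
  partial transpose (\<open>partial_transpose_rho\<close>). Hence both are positive semidefinite with
  Schmidt number at most two. If \<open>Psi\<close> is positive, the negative pairing rules out a decomposition
  of \<open>rho\<close> into product vectors; separable states have one, and partial transposition preserves
  such decompositions. So the state is entangled and both Schmidt numbers are exactly two. If \<open>Psi\<close>
  were the sum of a 2-positive map and a 2-copositive map, the first would pair nonnegatively with
  \<open>rho\<close>, the second with its partial transpose, and the sum could not be negative: this is
  atomicity.

  Positivity of \<open>Psi\<close> amounts to \<open>r\<^sup>2 \<le> p q\<close> and \<open>t\<^sup>2 \<le> p q\<close> (\<open>positive_map_PsiI\<close>,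
  \<open>positive_map_PsiD\<close>). Together with \<open>r\<^sup>2 + t\<^sup>2 > p q\<close> this forces \<open>r\<close> and \<open>t\<close> to be positive, which
  in turn makes both ranks equal to five (\<open>rank_rho\<close>, \<open>rank_partial_transpose_rho\<close>).
\<close>

section \<open>Rank-one decomposition of positive semidefinite matrices\<close>

definition quad :: "('n::finite) cmat \<Rightarrow> complex^'n \<Rightarrow> complex"
  where "quad A v = (\<Sum>i\<in>UNIV. \<Sum>j\<in>UNIV. cnj (v $ i) * A $ i $ j * v $ j)"

lemma psd_iff_quad: "psd A \<longleftrightarrow> (\<forall>v. quad A v \<in> \<real>\<^sub>\<ge>\<^sub>0)"
  by (simp add: psd_def quad_def)

lemma psd_0: "psd 0"
  by (simp add: psd_def)

lemma quad_add: "quad (A + B) v = quad A v + quad B v"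
  by (simp add: quad_def algebra_simps sum.distrib)

lemma psd_add: "psd A \<Longrightarrow> psd B \<Longrightarrow> psd (A + B)"
  by (simp add: psd_iff_quad quad_add)

lemma psd_sum: "(\<And>i. i \<in> I \<Longrightarrow> psd (A i)) \<Longrightarrow> psd (\<Sum>i\<in>I. A i)"
  by (induction I rule: infinite_finite_induct) (auto simp: psd_0 psd_add)

lemma quad_ketbra: "quad (ketbra x) v = of_real ((cmod (\<Sum>i\<in>UNIV. cnj (v $ i) * x $ i))\<^sup>2)"
proof -
  have "quad (ketbra x) v = (\<Sum>i\<in>UNIV. cnj (v $ i) * x $ i) * cnj (\<Sum>i\<in>UNIV. cnj (v $ i) * x $ i)"
    by (simp add: quad_def ketbra_def sum_product mult_ac)
      (rule sum.swap)
  then show ?thesis by (simp only: complex_norm_square)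
qed

lemma psd_ketbra: "psd (ketbra x)"
  by (simp add: psd_iff_quad quad_ketbra)

lemma sum_axis_mult: "(\<Sum>k\<in>UNIV. X k * axis i c $ k) = X i * (c::complex)"
  by (simp add: axis_def if_distrib cong: if_cong)

lemma sum_cnj_axis_mult: "(\<Sum>k\<in>UNIV. cnj (axis i c $ k) * X k) = cnj c * (X i::complex)"
proof -
  have "(\<Sum>k\<in>UNIV. cnj (axis i c $ k) * X k) = (\<Sum>k\<in>UNIV. X k * axis i (cnj c) $ k)"
    by (rule sum.cong) (auto simp: axis_def)
  then show ?thesis by (simp add: sum_axis_mult)
qed

text \<open>Moving a vector along one coordinate axis is the only variation that the following
  arguments need: all facts about positive semidefinite matrices below come from a choice
  of the coefficient \<open>c\<close>.\<close>

lemma quad_axis_add: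
  "quad A (axis i c + w) = cnj c * A $ i $ i * c + cnj c * (\<Sum>j\<in>UNIV. A $ i $ j * w $ j)
     + (\<Sum>k\<in>UNIV. cnj (w $ k) * A $ k $ i) * c + quad A w"
proof -
  have row: "quad A v = (\<Sum>k\<in>UNIV. cnj (v $ k) * (\<Sum>j\<in>UNIV. A $ k $ j * v $ j))" for v
    by (simp add: quad_def sum_distrib_left mult.assoc)
  show ?thesis
    by (simp only: row vector_add_component distrib_left distrib_right complex_cnj_add sum.distrib
        sum_axis_mult sum_cnj_axis_mult sum_distrib_right mult.assoc)
      (simp add: sum_distrib_right mult.assoc add_ac)
qed

lemma quad_axis: "quad A (axis i c) = cnj c * A $ i $ i * c"
  using quad_axis_add[of A i c 0] by (simp add: quad_def)

lemma psd_diag: "psd A \<Longrightarrow> A $ i $ i \<in> \<real>\<^sub>\<ge>\<^sub>0"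
  using quad_axis[of A i 1] by (auto simp: psd_iff_quad dest: spec[of _ "axis i 1"])

text \<open>Polarization: the form is real on the sums of a basis vector with \<open>1\<close> and with
  \<open>\<i>\<close> times another one, which fixes the imaginary and the real part of the
  difference between an entry and the conjugate of its mirror image.\<close>

lemma psd_hermitian:
  assumes "psd A"
  shows "A $ j $ i = cnj (A $ i $ j)"
proof -
  have q: "quad A (axis i c + axis j 1) \<in> \<real>\<^sub>\<ge>\<^sub>0" for c
    using assms by (simp add: psd_iff_quad)
  have e: "quad A (axis i c + axis j 1) = cnj c * A $ i $ i * c + cnj c * A $ i $ j
     + A $ j $ i * c + A $ j $ j" for c
    unfolding quad_axis_add quad_axis
    by (simp add: axis_def if_distrib if_distribR cong: if_cong)
  have "Im (A $ i $ i) = 0" "Im (A $ j $ j) = 0"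
    using psd_diag[OF assms] by (auto simp: complex_nonneg_Reals_iff)
  with q[of 1, unfolded e] q[of \<i>, unfolded e] show ?thesis
    by (auto simp: complex_nonneg_Reals_iff complex_eq_iff)
qed

lemma Re_quad_axis_add:
  assumes "psd A" and s: "s = (\<Sum>j\<in>UNIV. A $ i $ j * w $ j)"
  shows "Re (quad A (axis i c + w)) = Re (A $ i $ i) * (cmod c)\<^sup>2 + 2 * Re (cnj c * s) + Re (quad A w)"
proof -
  have 1: "(\<Sum>k\<in>UNIV. cnj (w $ k) * A $ k $ i) = cnj s"
    unfolding s cnj_sum by (rule sum.cong) (simp_all add: psd_hermitian[OF assms(1), of _ i] mult.commute)
  have im: "Im (A $ i $ i) = 0"
    using psd_diag[OF assms(1)] by (auto simp: complex_nonneg_Reals_iff)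
  show ?thesis
    unfolding quad_axis_add 1 s[symmetric]
    using im by (simp only: cmod_power2) (simp add: power2_eq_square algebra_simps)
qed

text \<open>Along \<open>- t A\<^sub>i\<^sub>j e\<^sub>i + e\<^sub>j\<close> the form is affine in \<open>t\<close> when the
  diagonal entry vanishes, so a nonzero slope would make it negative for large \<open>t\<close>.\<close>

lemma psd_zero_row:
  assumes "psd A" "A $ i $ i = 0"
  shows "A $ i $ j = 0"
proof -
  let ?s = "A $ i $ j"
  have *: "2 * t * (cmod ?s)\<^sup>2 \<le> Re (A $ j $ j)" for t
  proof -
    have "0 \<le> Re (quad A (axis i (of_real (-t) * ?s) + axis j 1))"
      using assms(1) by (auto simp: psd_iff_quad complex_nonneg_Reals_iff)
    also have "\<dots> = 2 * Re (cnj (of_real (-t) * ?s) * ?s) + Re (A $ j $ j)"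
      by (subst Re_quad_axis_add[OF assms(1), of ?s i "axis j 1"])
        (simp_all add: assms(2) quad_axis sum_axis_mult)
    also have "Re (cnj (of_real (-t) * ?s) * ?s) = - t * (cmod ?s)\<^sup>2"
      by (simp only: cmod_power2) (simp add: power2_eq_square algebra_simps)
    finally show ?thesis by simp
  qed
  \<comment> \<open>This value of t makes the left-hand side exceed the right-hand side by one.\<close>
  from *[of "(Re (A $ j $ j) + 1) / (2 * (cmod ?s)\<^sup>2)"]
  show ?thesis by (cases "?s = 0") auto
qed

text \<open>One step of the Cholesky algorithm. The form of the reduced matrix at \<open>w\<close> is the
  minimum over \<open>c\<close> of the form of \<open>A\<close> at \<open>c e\<^sub>i + w\<close>; it is attained at
  \<open>c = - (A w)\<^sub>i / a\<close>.\<close>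

lemma psd_minus_ketbra_column:
  assumes "psd A" and a: "A $ i $ i = of_real a" "a > 0"
  shows "psd (A - ketbra (\<chi> k. A $ k $ i / of_real (sqrt a)))" (is "psd (A - ketbra ?b)")
  unfolding psd_iff_quad
proof
  fix w
  define s where "s = (\<Sum>j\<in>UNIV. A $ i $ j * w $ j)"
  have cs: "(\<Sum>k\<in>UNIV. cnj (w $ k) * A $ k $ i) = cnj s"
    unfolding s_def cnj_sum by (rule sum.cong) (simp_all add: psd_hermitian[OF assms(1), of _ i] mult.commute)
  have "quad (A - ketbra ?b) w = quad A w - quad (ketbra ?b) w"
    using quad_add[of "A - ketbra ?b" "ketbra ?b" w] by simp
  also have "(\<Sum>k\<in>UNIV. cnj (w $ k) * ?b $ k) = cnj s / of_real (sqrt a)"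
    unfolding cs[symmetric] by (simp add: sum_divide_distrib)
  then have "quad (ketbra ?b) w = of_real ((cmod s)\<^sup>2 / a)"
    unfolding quad_ketbra using a(2) by (simp add: norm_divide power_divide)
  finally have *: "quad (A - ketbra ?b) w = quad A w - of_real ((cmod s)\<^sup>2 / a)" .
  have "0 \<le> Re (quad A (axis i (- s / of_real a) + w))"
    using assms(1) by (auto simp: psd_iff_quad complex_nonneg_Reals_iff)
  also have "\<dots> = a * (cmod s / a)\<^sup>2 + 2 * Re (cnj (- s / of_real a) * s) + Re (quad A w)"
    using a(2) by (subst Re_quad_axis_add[OF assms(1) s_def]) (simp add: a(1) norm_divide)
  also have "Re (cnj (- s / of_real a) * s) = - (cmod s)\<^sup>2 / a"
    by (simp only: cmod_power2) (simp add: power2_eq_square add_divide_distrib diff_divide_distrib)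
  also have "a * (cmod s / a)\<^sup>2 + 2 * (- (cmod s)\<^sup>2 / a) + Re (quad A w) = Re (quad A w) - (cmod s)\<^sup>2 / a"
    using a(2) by (simp add: power2_eq_square)
  finally show "quad (A - ketbra ?b) w \<in> \<real>\<^sub>\<ge>\<^sub>0"
    using assms(1) unfolding * by (auto simp: psd_iff_quad complex_nonneg_Reals_iff)
qed

text \<open>Cholesky elimination: each step clears a nonzero diagonal entry and keeps the zero ones,
  and a positive semidefinite matrix with zero diagonal is zero.\<close>

lemma psd_eq_sum_ketbra:
  assumes "psd A"
  shows "\<exists>(n::nat) v. A = (\<Sum>i<n. ketbra (v i))"
  using assms
proof (induction "card {i. A $ i $ i \<noteq> 0}" arbitrary: A rule: less_induct)
  case less
  show ?case
  proof (cases "\<forall>i. A $ i $ i = 0")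
    case True
    then have "A = 0"
      using psd_zero_row[OF less.prems] by (simp add: vec_eq_iff)
    then show ?thesis by (intro exI[of _ 0]) simp
  next
    case False
    then obtain i where i: "A $ i $ i \<noteq> 0" by auto
    define a where "a = Re (A $ i $ i)"
    have a: "A $ i $ i = of_real a" "a > 0"
      using psd_diag[OF less.prems, of i] i by (auto simp: a_def complex_nonneg_Reals_iff complex_eq_iff)
    define b where "b = (\<chi> k. A $ k $ i / of_real (sqrt a))"
    have psd: "psd (A - ketbra b)"
      unfolding b_def by (rule psd_minus_ketbra_column[OF less.prems a])
    have "of_real (sqrt a) * of_real (sqrt a) = (of_real a :: complex)"
      using a(2) by (simp flip: of_real_mult)
    then have "(A - ketbra b) $ i $ i = 0"
      using a by (simp add: b_def ketbra_def)
    moreover have "(A - ketbra b) $ j $ j = 0" if "A $ j $ j = 0" for j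
      using psd_zero_row[OF less.prems that, of i] that by (simp add: b_def ketbra_def)
    ultimately have "{j. (A - ketbra b) $ j $ j \<noteq> 0} \<subset> {j. A $ j $ j \<noteq> 0}"
      using i by blast
    then have "card {j. (A - ketbra b) $ j $ j \<noteq> 0} < card {j. A $ j $ j \<noteq> 0}"
      by (intro psubset_card_mono) auto
    from less.hyps[OF this psd] obtain n :: nat and v
      where "A - ketbra b = (\<Sum>i<n. ketbra (v i))" by blast
    then have "A = (\<Sum>i<Suc n. ketbra ((v(n := b)) i))"
      by (simp add: algebra_simps)
    then show ?thesis by blast
  qed
qed

section \<open>The pairing between maps and bipartite matrices\<close>

lemma vector_space_mscale: "vector_space (mscale :: complex \<Rightarrow> ('n::finite) cmat \<Rightarrow> _)"
  by unfold_locales (auto simp: mscale_def vec_eq_iff algebra_simps)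

lemma linear_mscale_iff:
  "Vector_Spaces.linear mscale mscale \<Phi> \<longleftrightarrow>
     (\<forall>X Y. \<Phi> (X + Y) = \<Phi> X + \<Phi> Y) \<and> (\<forall>c X. \<Phi> (mscale c X) = mscale c (\<Phi> X))"
  by (simp add: Vector_Spaces.linear_iff vector_space_mscale)

lemma mscale_linear_sum:
  assumes "Vector_Spaces.linear mscale mscale \<Phi>"
  shows "\<Phi> (\<Sum>i\<in>I. X i) = (\<Sum>i\<in>I. \<Phi> (X i))"
proof -
  have "\<Phi> 0 = 0"
    using assms linear_mscale_iff[of \<Phi>] by (metis add_cancel_right_left)
  then show ?thesis
    using assms by (induction I rule: infinite_finite_induct) (simp_all add: linear_mscale_iff)
qed

definition matrix_unit :: "'n::finite \<Rightarrow> 'n \<Rightarrow> 'n cmat"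
  where "matrix_unit i j = (\<chi> k l. if k = i \<and> l = j then 1 else 0)"

lemma cmat_eq_sum_matrix_units:
  fixes X :: "('n::finite) cmat"
  shows "X = (\<Sum>i\<in>UNIV. \<Sum>j\<in>UNIV. mscale (X $ i $ j) (matrix_unit i j))"
proof -
  have "(\<Sum>i\<in>UNIV. \<Sum>j\<in>UNIV. X $ i $ j * (if k = i \<and> l = j then 1 else 0)) = X $ k $ l" for k l
  proof -
    have "(\<Sum>j\<in>UNIV. X $ i $ j * (if k = i \<and> l = j then 1 else 0)) = (if k = i then X $ i $ l else 0)" for i
      by (simp add: if_distrib cong: if_cong)
    then show ?thesis by simp
  qed
  then show ?thesis by (simp add: vec_eq_iff mscale_def matrix_unit_def)
qed

text \<open>The trace of the product of \<open>\<rho>\<close> with the Choi matrix of \<open>\<Phi>\<close>.\<close>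

definition pairing :: "(('m::finite) cmat \<Rightarrow> ('n::finite) cmat) \<Rightarrow> ('m \<times> 'n) cmat \<Rightarrow> complex"
  where "pairing \<Phi> \<rho> = (\<Sum>u\<in>UNIV. \<Sum>v\<in>UNIV.
     \<Phi> (matrix_unit (fst u) (fst v)) $ snd u $ snd v * \<rho> $ v $ u)"

lemma pairing_add_right: "pairing \<Phi> (\<rho> + \<sigma>) = pairing \<Phi> \<rho> + pairing \<Phi> \<sigma>"
  by (simp add: pairing_def distrib_left sum.distrib)

lemma pairing_scaleR_right: "pairing \<Phi> (c *\<^sub>R \<rho>) = c *\<^sub>R pairing \<Phi> \<rho>"
  by (simp add: pairing_def scaleR_sum_right)

lemma pairing_sum_right: "pairing \<Phi> (\<Sum>i\<in>I. \<rho> i) = (\<Sum>i\<in>I. pairing \<Phi> (\<rho> i))"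
  by (induction I rule: infinite_finite_induct) (simp_all add: pairing_add_right, simp_all add: pairing_def)

lemma pairing_add_left: "pairing (\<lambda>X. \<Phi> X + \<Psi> X) \<rho> = pairing \<Phi> \<rho> + pairing \<Psi> \<rho>"
  by (simp add: pairing_def distrib_right sum.distrib)

text \<open>Transposing the output of the map and the second tensor factor of the matrix relabels the
  same summands. This is how copositive maps are tested on the partial transpose.\<close>

lemma pairing_partial_transpose: "pairing (transpose \<circ> \<Phi>) (partial_transpose \<rho>) = pairing \<Phi> \<rho>"
  unfolding pairing_def sum.cartesian_product
  by (rule sum.reindex_bij_witness[where
        i = "\<lambda>(u, v). ((fst u, snd v), (fst v, snd u))" and
        j = "\<lambda>(u, v). ((fst u, snd v), (fst v, snd u))"])
    (auto simp: transpose_def partial_transpose_def)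

text \<open>The identity behind the duality: a vector that is a sum of \<open>k\<close> product vectors turns the
  Choi form of \<open>\<Phi>\<close> into the form of the \<open>k\<close>-fold ampliation of \<open>\<Phi>\<close>, applied to a
  rank-one matrix. The left tensor factors build that rank-one matrix (conjugated, since
  contracting the Choi matrix with \<open>x\<close> on both sides evaluates \<open>\<Phi>\<close> at the transpose
  of \<open>ketbra x\<close>), the right ones the vector at which the form is evaluated.\<close>

lemma pairing_ketbra_sum_vtensor:
  fixes x :: "'k::finite \<Rightarrow> complex^('m::finite)" and y :: "'k \<Rightarrow> complex^('n::finite)"
  assumes "Vector_Spaces.linear mscale mscale \<Phi>"
  shows "pairing \<Phi> (ketbra (\<Sum>a\<in>UNIV. vtensor (x a) (y a))) =
    quad (ampliation \<Phi> (ketbra (\<chi> u. cnj (x (fst u) $ snd u)))) (\<chi> u. y (fst u) $ snd u)"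
proof -
  let ?E = "\<lambda>i j. \<Phi> (matrix_unit i j)"
  have expand: "\<Phi> (\<chi> i j. M i j) $ k $ l = (\<Sum>i\<in>UNIV. \<Sum>j\<in>UNIV. M i j * ?E i j $ k $ l)" for M k l
    by (subst cmat_eq_sum_matrix_units)
      (use assms in \<open>simp add: mscale_linear_sum[OF assms] linear_mscale_iff mscale_def\<close>)
  have "pairing \<Phi> (ketbra (\<Sum>a\<in>UNIV. vtensor (x a) (y a))) =
    (\<Sum>u\<in>UNIV. \<Sum>v\<in>UNIV. \<Sum>b\<in>UNIV. \<Sum>a\<in>UNIV. ?E (fst u) (fst v) $ snd u $ snd v *
        (x b $ fst v * y b $ snd v * cnj (x a $ fst u * y a $ snd u)))"
    by (simp only: pairing_def ketbra_def vec_lambda_beta sum_component vtensor_def cnj_sum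
        sum_product) (simp only: sum_distrib_left)
  also have "\<dots> = (\<Sum>u\<in>UNIV. \<Sum>v\<in>UNIV. \<Sum>i\<in>UNIV. \<Sum>j\<in>UNIV.
      cnj (y (fst u) $ snd u) * (cnj (x (fst u) $ i) * x (fst v) $ j * ?E i j $ snd u $ snd v) * y (fst v) $ snd v)"
    unfolding sum.cartesian_product
    by (rule sum.reindex_bij_witness[where
        j = "\<lambda>(u, v, b, a). ((a, snd u), (b, snd v), fst u, fst v)" and
        i = "\<lambda>(u, v, i, j). ((i, snd u), (j, snd v), fst v, fst u)"])
      (auto simp: mult_ac)
  also have "\<dots> = quad (ampliation \<Phi> (ketbra (\<chi> u. cnj (x (fst u) $ snd u)))) (\<chi> u. y (fst u) $ snd u)"
    by (simp add: quad_def ampliation_def ketbra_def expand sum_distrib_left sum_distrib_right)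
  finally show ?thesis .
qed

lemma pairing_ketbra_nonneg:
  fixes x :: "'k::finite \<Rightarrow> complex^('m::finite)" and y :: "'k \<Rightarrow> complex^('n::finite)"
  assumes "k_positive TYPE('k) \<Phi>"
  shows "pairing \<Phi> (ketbra (\<Sum>a\<in>UNIV. vtensor (x a) (y a))) \<in> \<real>\<^sub>\<ge>\<^sub>0"
proof -
  have "psd (ampliation \<Phi> (ketbra (\<chi> u. cnj (x (fst u :: 'k) $ snd u))))"
    using assms psd_ketbra unfolding k_positive_def positive_map_def by blast
  then show ?thesis
    using assms by (simp add: pairing_ketbra_sum_vtensor k_positive_def psd_iff_quad)
qed

text \<open>A matrix over \<open>1 \<times> 'a\<close> is a matrix over \<open>'a\<close> up to relabelling, so the case of product
  vectors needs no separate treatment.\<close>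

lemma positive_map_imp_1_positive:
  assumes "positive_map \<Phi>"
  shows "k_positive TYPE(1) \<Phi>"
proof -
  have lin: "Vector_Spaces.linear mscale mscale \<Phi>"
    using assms by (simp add: positive_map_def)
  have "Vector_Spaces.linear mscale mscale (ampliation \<Phi> :: (1 \<times> _) cmat \<Rightarrow> _)"
    unfolding linear_mscale_iff
  proof (intro conjI allI)
    fix X Y :: "(1 \<times> 'a) cmat" and c
    let ?b = "\<lambda>X :: (1 \<times> 'a) cmat. \<lambda>u v. (\<chi> i j. X $ (u, i) $ (v, j)) :: 'a cmat"
    have "?b (X + Y) u v = ?b X u v + ?b Y u v" "?b (mscale c X) u v = mscale c (?b X u v)" for u v
      by (simp_all add: vec_eq_iff mscale_def)
    then have "\<Phi> (?b (X + Y) u v) = \<Phi> (?b X u v) + \<Phi> (?b Y u v)"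
      "\<Phi> (?b (mscale c X) u v) = mscale c (\<Phi> (?b X u v))" for u v
      using lin unfolding linear_mscale_iff by metis+
    then show "ampliation \<Phi> (X + Y) = ampliation \<Phi> X + ampliation \<Phi> Y"
      "ampliation \<Phi> (mscale c X) = mscale c (ampliation \<Phi> X)"
      unfolding ampliation_def by (simp_all add: vec_eq_iff mscale_def)
  qed
  moreover have "psd (ampliation \<Phi> X)" if "psd X" for X :: "(1 \<times> 'a) cmat"
  proof -
    have s: "(\<Sum>u\<in>UNIV. f u) = (\<Sum>i\<in>UNIV. f (1, i))" for f :: "1 \<times> 'c::finite \<Rightarrow> complex"
      by (rule sum.reindex_bij_witness[where i = "\<lambda>i. (1, i)" and j = snd]) (auto, (metis num1_eq1)+)
    have "quad (\<chi> i j. X $ (1, i) $ (1, j)) v = quad X (\<chi> u. v $ snd u)" for v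
      by (simp add: quad_def s)
    then have "psd (\<chi> i j. X $ (1, i) $ (1, j))"
      using that by (simp add: psd_iff_quad)
    then have "psd (\<Phi> (\<chi> i j. X $ (1, i) $ (1, j)))"
      using assms by (simp add: positive_map_def)
    moreover have "quad (ampliation \<Phi> X) v = quad (\<Phi> (\<chi> i j. X $ (1, i) $ (1, j))) (\<chi> i. v $ (1, i))" for v
      by (simp add: quad_def s ampliation_def)
    ultimately show ?thesis by (simp add: psd_iff_quad)
  qed
  ultimately show ?thesis
    using lin by (simp add: k_positive_def positive_map_def)
qed

section \<open>Schmidt rank and Schmidt number\<close>

text \<open>The condition inside the minimum that defines the Schmidt number; for each \<open>k\<close> it describes
  a convex cone.\<close>

definition schmidt_bounded :: "nat \<Rightarrow> ('a::finite \<times> 'b::finite) cmat \<Rightarrow> bool"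
  where "schmidt_bounded k \<rho> \<longleftrightarrow>
    (\<exists>(n::nat) v. (\<forall>i<n. schmidt_rank (v i) \<le> k) \<and> \<rho> = (\<Sum>i<n. ketbra (v i)))"

lemma schmidt_bounded_mono: "schmidt_bounded k \<rho> \<Longrightarrow> k \<le> l \<Longrightarrow> schmidt_bounded l \<rho>"
  unfolding schmidt_bounded_def by (elim ex_forward conj_forward all_forward imp_forward) auto

lemma schmidt_bounded_ketbra: "schmidt_rank v \<le> k \<Longrightarrow> schmidt_bounded k (ketbra v)"
  unfolding schmidt_bounded_def by (intro exI[of _ 1] exI[of _ "\<lambda>_. v"]) simp

lemma schmidt_bounded_0: "schmidt_bounded k 0"
  unfolding schmidt_bounded_def by (intro exI[of _ 0]) simp

lemma schmidt_bounded_add: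
  assumes "schmidt_bounded k \<rho>" "schmidt_bounded k \<sigma>"
  shows "schmidt_bounded k (\<rho> + \<sigma>)"
proof -
  obtain n :: nat and v where v: "\<forall>i<n. schmidt_rank (v i) \<le> k" "\<rho> = (\<Sum>i<n. ketbra (v i))"
    using assms(1) unfolding schmidt_bounded_def by blast
  obtain m :: nat and w where w: "\<forall>i<m. schmidt_rank (w i) \<le> k" "\<sigma> = (\<Sum>i<m. ketbra (w i))"
    using assms(2) unfolding schmidt_bounded_def by blast
  define z where "z i = (if i < n then v i else w (i - n))" for i
  have "(\<Sum>i<n+m. ketbra (z i)) = (\<Sum>i<n. ketbra (z i)) + (\<Sum>i<m. ketbra (z (n + i)))"
    by (induction m) (simp_all add: add.assoc)
  also have "\<dots> = \<rho> + \<sigma>"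
    by (simp add: z_def v w)
  finally show ?thesis
    using v w unfolding schmidt_bounded_def
    by (intro exI[of _ "n + m"] exI[of _ z]) (auto simp: z_def)
qed

lemma schmidt_bounded_sum:
  "(\<And>i. i \<in> I \<Longrightarrow> schmidt_bounded k (\<rho> i)) \<Longrightarrow> schmidt_bounded k (\<Sum>i\<in>I. \<rho> i)"
  by (induction I rule: infinite_finite_induct) (auto simp: schmidt_bounded_0 schmidt_bounded_add)

lemma schmidt_rank_sum_vtensor:
  fixes K :: "'k set"
  assumes "finite K"
  shows "schmidt_rank (\<Sum>a\<in>K. vtensor (x a) (y a)) \<le> card K"
proof -
  let ?A = "\<chi> i j. (\<Sum>a\<in>K. vtensor (x a) (y a)) $ (i, j)"
  have "row i ?A = (\<Sum>a\<in>K. x a $ i *s y a)" for i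
    by (simp add: vec_eq_iff row_def vtensor_def)
  then have "rows ?A \<subseteq> vec.span (y ` K)"
    by (auto simp: rows_def simp del: sum_component intro!: vec.span_sum intro: vec.span_scale vec.span_base)
  then have "vec.dim (rows ?A) \<le> card (y ` K)"
    using assms by (intro vec.dim_le_card) auto
  then show ?thesis
    using card_image_le[OF assms, of y] by (simp add: schmidt_rank_def row_rank_def_gen)
qed

text \<open>The rows of the coefficient matrix are combinations of a basis of the row space. The basis
  vectors become the right factors and the coordinates of the rows the left ones; indices of
  \<open>'k\<close> outside the basis get the coefficient zero.\<close>

lemma schmidt_decomposition:
  fixes v :: "complex^('a::finite \<times> 'b::finite)"
  assumes "schmidt_rank v \<le> CARD('k::finite)"
  obtains x y where "v = (\<Sum>a\<in>(UNIV :: 'k set). vtensor (x a) (y a))"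
proof -
  let ?A = "(\<chi> i j. v $ (i, j)) :: complex^'b^'a"
  obtain B where B: "vec.independent B" "rows ?A \<subseteq> vec.span B" "card B = vec.dim (rows ?A)"
    by (rule vec.basis_exists[of "rows ?A"])
  have fin: "finite B"
    using B(1) by (rule vec.finiteI_independent)
  have "card B \<le> card (UNIV :: 'k set)"
    using assms B(3) by (simp add: schmidt_rank_def row_rank_def_gen)
  then obtain f :: "_ \<Rightarrow> 'k" where f: "inj_on f B"
    using card_le_inj[OF fin, of "UNIV :: 'k set"] by auto
  define R where "R i = vec.representation B (row i ?A)" for i
  define x where "x a = (if a \<in> f ` B then \<chi> i. R i (inv_into B f a) else 0)" for a
  have "v $ (i, j) = (\<Sum>a\<in>UNIV. vtensor (x a) (inv_into B f a)) $ (i, j)" for i j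
  proof -
    have "row i ?A \<in> vec.span B"
      using B(2) by (auto simp: rows_def)
    then have "row i ?A = (\<Sum>b\<in>B. R i b *s b)"
      unfolding R_def using B(1) fin by (intro vec.sum_representation_eq[symmetric]) auto
    then have "v $ (i, j) = (\<Sum>b\<in>B. R i b * b $ j)"
      by (simp add: row_def vec_eq_iff)
    also have "\<dots> = (\<Sum>a\<in>f ` B. R i (inv_into B f a) * inv_into B f a $ j)"
      using f by (simp add: sum.reindex)
    also have "\<dots> = (\<Sum>a\<in>UNIV. x a $ i * inv_into B f a $ j)"
      by (rule sum.mono_neutral_cong_left) (auto simp: x_def)
    finally show ?thesis by (simp add: vtensor_def)
  qed
  then have "v = (\<Sum>a\<in>UNIV. vtensor (x a) (inv_into B f a))"
    by (simp add: vec_eq_iff split_paired_all)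
  then show ?thesis by (rule that)
qed

lemma schmidt_rank_vtensor: "schmidt_rank (vtensor x y) \<le> 1"
  using schmidt_rank_sum_vtensor[of "{()}" "\<lambda>_. x" "\<lambda>_. y"] by simp

lemma schmidt_rank_vtensor_add: "schmidt_rank (vtensor x y + vtensor x' y') \<le> 2"
  using schmidt_rank_sum_vtensor[of "{0, 1::nat}" "\<lambda>a. if a = 0 then x else x'" "\<lambda>a. if a = 0 then y else y'"]
  by simp

lemma schmidt_rank_scaleR: "schmidt_rank (c *\<^sub>R v) \<le> schmidt_rank v"
proof -
  have "row i (\<chi> i j. (c *\<^sub>R v) $ (i, j)) = of_real c *s row i (\<chi> i j. v $ (i, j))" for i
    by (simp add: row_def vec_eq_iff scaleR_conv_of_real[where 'a = complex])
  then have "rows (\<chi> i j. (c *\<^sub>R v) $ (i, j)) \<subseteq> vec.span (rows (\<chi> i j. v $ (i, j)))"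
    by (auto simp: rows_def intro: vec.span_scale vec.span_base)
  then show ?thesis
    unfolding schmidt_rank_def row_rank_def_gen by (rule vec.dim_mono)
qed

lemma ketbra_scaleR: "ketbra (c *\<^sub>R v) = c\<^sup>2 *\<^sub>R ketbra v"
  by (simp add: ketbra_def vec_eq_iff power2_eq_square)

lemma schmidt_bounded_scaleR:
  assumes "schmidt_bounded k \<rho>" "c \<ge> 0"
  shows "schmidt_bounded k (c *\<^sub>R \<rho>)"
proof -
  obtain n :: nat and v where v: "\<forall>i<n. schmidt_rank (v i) \<le> k" "\<rho> = (\<Sum>i<n. ketbra (v i))"
    using assms(1) unfolding schmidt_bounded_def by blast
  have "c *\<^sub>R \<rho> = (\<Sum>i<n. ketbra (sqrt c *\<^sub>R v i))"
    using assms(2) by (simp add: v ketbra_scaleR scaleR_sum_right)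
  moreover have "\<forall>i<n. schmidt_rank (sqrt c *\<^sub>R v i) \<le> k"
    using v(1) schmidt_rank_scaleR le_trans by blast
  ultimately show ?thesis unfolding schmidt_bounded_def
    by (intro exI[of _ n] exI[of _ "\<lambda>i. sqrt c *\<^sub>R v i"]) simp
qed

text \<open>The duality between \<open>k\<close>-positive maps and matrices of Schmidt number at most \<open>k\<close>. It
  turns a map with a negative pairing into a proof that the Schmidt number is large, and a
  matrix with a negative pairing into a proof that the map is not \<open>k\<close>-positive.\<close>

lemma pairing_nonneg:
  assumes "k_positive TYPE('k::finite) \<Phi>" "schmidt_bounded CARD('k) \<rho>"
  shows "pairing \<Phi> \<rho> \<in> \<real>\<^sub>\<ge>\<^sub>0"
proof -
  obtain n :: nat and v where v: "\<forall>i<n. schmidt_rank (v i) \<le> CARD('k)" "\<rho> = (\<Sum>i<n. ketbra (v i))"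
    using assms(2) unfolding schmidt_bounded_def by blast
  have "pairing \<Phi> (ketbra (v i)) \<in> \<real>\<^sub>\<ge>\<^sub>0" if "i < n" for i
  proof -
    have "schmidt_rank (v i) \<le> CARD('k)" using v(1) that by simp
    then obtain x y where "v i = (\<Sum>a\<in>(UNIV :: 'k set). vtensor (x a) (y a))"
      by (rule schmidt_decomposition)
    then show ?thesis using pairing_ketbra_nonneg[OF assms(1)] by simp
  qed
  then show ?thesis
    unfolding v(2) pairing_sum_right by (auto simp: complex_nonneg_Reals_iff intro!: sum_nonneg)
qed

lemma positive_map_pairing_nonneg:
  "positive_map \<Phi> \<Longrightarrow> schmidt_bounded 1 \<rho> \<Longrightarrow> pairing \<Phi> \<rho> \<in> \<real>\<^sub>\<ge>\<^sub>0"
  using pairing_nonneg[OF positive_map_imp_1_positive, of \<Phi> \<rho>] by simp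

lemma schmidt_bounded_mtensor:
  assumes "psd A" "psd B"
  shows "schmidt_bounded 1 (mtensor A B)"
proof -
  obtain n x where A: "A = (\<Sum>i<n::nat. ketbra (x i))" using psd_eq_sum_ketbra[OF assms(1)] by blast
  obtain m y where B: "B = (\<Sum>i<m::nat. ketbra (y i))" using psd_eq_sum_ketbra[OF assms(2)] by blast
  have "mtensor A B = (\<Sum>i<n. \<Sum>j<m. ketbra (vtensor (x i) (y j)))"
    unfolding A B by (simp add: mtensor_def ketbra_def vtensor_def vec_eq_iff sum_product mult_ac)
  then show ?thesis
    by (simp only:) (intro schmidt_bounded_sum schmidt_bounded_ketbra schmidt_rank_vtensor)
qed

text \<open>Decomposing both factors of a product state into rank-one matrices gives product vectors,
  and the cone is convex.\<close>

lemma separable_imp_schmidt_bounded: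
  assumes "separable_state \<rho>"
  shows "schmidt_bounded 1 \<rho>"
proof -
  have "convex {\<rho> :: ('a \<times> 'b) cmat. schmidt_bounded 1 \<rho>}"
    by (auto simp: convex_def intro: schmidt_bounded_add schmidt_bounded_scaleR)
  then have "convex hull {mtensor A B |A B. is_state A \<and> is_state B} \<subseteq> {\<rho> :: ('a \<times> 'b) cmat. schmidt_bounded 1 \<rho>}"
    by (intro hull_minimal) (auto simp: is_state_def simp del: One_nat_def intro: schmidt_bounded_mtensor)
  then show ?thesis using assms by (auto simp: separable_state_def)
qed

lemma partial_transpose_scaleR: "partial_transpose (c *\<^sub>R \<rho>) = c *\<^sub>R partial_transpose \<rho>"
  by (simp add: partial_transpose_def vec_eq_iff)

lemma partial_transpose_sum: "partial_transpose (\<Sum>i\<in>I. \<rho> i) = (\<Sum>i\<in>I. partial_transpose (\<rho> i))"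
  by (simp add: partial_transpose_def vec_eq_iff)

lemma partial_transpose_partial_transpose [simp]: "partial_transpose (partial_transpose \<rho>) = \<rho>"
  by (simp add: partial_transpose_def vec_eq_iff)

text \<open>Partial transposition of \<open>ketbra v\<close> for a product vector \<open>v\<close> conjugates its second factor.
  For larger Schmidt rank the
  partial transpose of \<open>ketbra v\<close> is not even positive semidefinite.\<close>

lemma schmidt_bounded_partial_transpose:
  assumes "schmidt_bounded 1 \<rho>"
  shows "schmidt_bounded 1 (partial_transpose \<rho>)"
proof -
  obtain n :: nat and v where v: "\<forall>i<n. schmidt_rank (v i) \<le> 1" "\<rho> = (\<Sum>i<n. ketbra (v i))"
    using assms unfolding schmidt_bounded_def by blast
  have "schmidt_bounded 1 (partial_transpose (ketbra (v i)))" if "i < n" for i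
  proof -
    have "schmidt_rank (v i) \<le> CARD(1)" using v(1) that by simp
    then obtain x y where xy: "v i = (\<Sum>a\<in>(UNIV :: 1 set). vtensor (x a) (y a))"
      by (rule schmidt_decomposition)
    have "partial_transpose (ketbra (v i)) = ketbra (vtensor (x 1) (\<chi> j. cnj (y 1 $ j)))"
      by (simp add: xy partial_transpose_def ketbra_def vtensor_def vec_eq_iff)
    then show ?thesis
      by (simp add: schmidt_bounded_ketbra schmidt_rank_vtensor[simplified])
  qed
  then show ?thesis unfolding v(2) partial_transpose_sum by (intro schmidt_bounded_sum) auto
qed

lemma schmidt_number_eq_2:
  assumes "schmidt_bounded 2 \<rho>" "\<not> schmidt_bounded 1 \<rho>"
  shows "schmidt_number \<rho> = 2"
  unfolding schmidt_number_def schmidt_bounded_def[symmetric]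
proof (rule Least_equality)
  show "schmidt_bounded 2 \<rho>" by (rule assms(1))
next
  fix k assume "schmidt_bounded k \<rho>"
  then show "2 \<le> k"
    using assms(2) schmidt_bounded_mono[of k \<rho> 1] by linarith
qed

text \<open>The rows indexed by \<open>S\<close> are independent because each has a pivot in a column where the others
  vanish, and they span the row space.\<close>

lemma rank_eq_card_pivots:
  fixes A :: "'n::finite cmat"
  assumes diag: "\<And>u. u \<in> S \<Longrightarrow> A $ u $ u \<noteq> 0"
    and off: "\<And>u v. u \<in> S \<Longrightarrow> v \<in> S \<Longrightarrow> u \<noteq> v \<Longrightarrow> A $ u $ v = 0"
    and rows: "\<And>u. u \<notin> S \<Longrightarrow> \<exists>v\<in>S. \<exists>c. A $ u = c *s A $ v"
  shows "rank A = card S"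
proof -
  have inj: "inj_on (($) A) S"
    by (rule inj_onI) (metis diag off)
  have ind: "vec.independent (($) A ` S)"
    unfolding vec.independent_explicit
  proof (intro conjI allI impI ballI)
    fix f w assume sum: "(\<Sum>v\<in>($) A ` S. f v *s v) = 0" and "w \<in> ($) A ` S"
    then obtain u where u: "u \<in> S" "w = A $ u" by blast
    have "0 = (\<Sum>v\<in>S. f (A $ v) * A $ v $ u)"
      using arg_cong[OF sum, of "\<lambda>x. x $ u"] inj by (simp add: sum.reindex)
    also have "\<dots> = (\<Sum>v\<in>S. if v = u then f (A $ u) * A $ u $ u else 0)"
      by (rule sum.cong) (auto simp: off u)
    also have "\<dots> = f (A $ u) * A $ u $ u"
      using u by simp
    finally show "f w = 0" using diag u by simp
  qed simp
  have row: "row u A = A $ u" for u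
    by (simp add: row_def vec_eq_iff)
  have "rows A \<subseteq> vec.span (($) A ` S)"
  proof
    fix w assume "w \<in> rows A"
    then obtain u where "w = A $ u" by (auto simp: rows_def row)
    moreover have "A $ u = 1 *s A $ u" by simp
    ultimately obtain v c where "v \<in> S" "w = c *s A $ v" using rows[of u] by blast
    then show "w \<in> vec.span (($) A ` S)"
      by (simp add: vec.span_scale vec.span_base)
  qed
  then have "vec.dim (rows A) = card (($) A ` S)"
    using ind by (intro vec.dim_unique[of "($) A ` S"]) (auto simp: rows_def row)
  then show ?thesis
    using inj by (simp add: row_rank_def_gen card_image)
qed

section \<open>Positivity of the maps\<close>

lemma sum_UNIV_3x3: "(\<Sum>u\<in>UNIV. f u) = (\<Sum>i\<in>UNIV. \<Sum>j\<in>UNIV. f (i :: 3, j :: 3))"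
  by (simp add: sum.cartesian_product)

lemma forall_3x3: "(\<forall>u. P u) \<longleftrightarrow> (\<forall>i j. P (i :: 3, j :: 3))"
  by (simp add: split_paired_all)

lemma linear_Psi: "Vector_Spaces.linear mscale mscale (Psi p q r t)"
  unfolding linear_mscale_iff
  by (simp add: Psi_def mscale_def vec_eq_iff forall_3 algebra_simps)

lemma quad_Psi_ketbra:
  "quad (Psi p q r t (ketbra x)) y = of_real (p * ((cmod (x$1))\<^sup>2 + (cmod (x$2))\<^sup>2) * ((cmod (y$1))\<^sup>2 + (cmod (y$2))\<^sup>2)
     + q * (cmod (x$3))\<^sup>2 * (cmod (y$3))\<^sup>2
     + 2 * r * Re (x$1 * cnj (x$3) * cnj (y$1) * y$3) + 2 * t * Re (x$3 * cnj (x$2) * cnj (y$2) * y$3))"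
  by (simp add: quad_def Psi_def ketbra_def sum_3 complex_eq_iff cmod_power2)
    (simp add: algebra_simps power2_eq_square)

text \<open>Rank-one matrices suffice. With the absolute values \<open>a, b, e\<close> and \<open>c, d, f\<close> of the
  coordinates of \<open>x\<close> and \<open>y\<close>, the form is at least
  \<open>(\<surd>p (a c + b d) - \<surd>q e f)\<^sup>2 + p (a d - b c)\<^sup>2\<close>, because \<open>r\<close> and \<open>t\<close> are at most
  \<open>\<surd>(p q)\<close> and a real part is at least the negative of the absolute value;
  the second square is the defect in the Cauchy-Schwarz inequality.\<close>

lemma positive_map_PsiI:
  assumes "p > 0" "q > 0" "r \<ge> 0" "t \<ge> 0" "r\<^sup>2 \<le> p * q" "t\<^sup>2 \<le> p * q"
  shows "positive_map (Psi p q r t)"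
proof -
  have "psd (Psi p q r t (ketbra x))" for x
    unfolding psd_iff_quad
  proof
    fix y :: "complex^3"
    define a b e c d f where "a = cmod (x$1)" "b = cmod (x$2)" "e = cmod (x$3)"
      "c = cmod (y$1)" "d = cmod (y$2)" "f = cmod (y$3)"
    note ab = this
    have re: "Re z \<ge> - cmod z" for z
      using abs_Re_le_cmod[of z] by linarith
    have sq: "r \<le> sqrt (p * q)" "t \<le> sqrt (p * q)"
      using assms by (auto intro: real_le_rsqrt)
    have 1: "r * Re (x$1 * cnj (x$3) * cnj (y$1) * y$3) \<ge> - sqrt (p * q) * (a * e * c * f)"
    proof -
      have "r * (a * e * c * f) \<le> sqrt (p * q) * (a * e * c * f)"
        using sq by (intro mult_right_mono) (auto simp: ab)
      moreover have "r * Re (x$1 * cnj (x$3) * cnj (y$1) * y$3) \<ge> r * - (a * e * c * f)"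
        using assms re[of "x$1 * cnj (x$3) * cnj (y$1) * y$3"]
        by (intro mult_left_mono) (auto simp: ab norm_mult)
      ultimately show ?thesis by simp
    qed
    have 2: "t * Re (x$3 * cnj (x$2) * cnj (y$2) * y$3) \<ge> - sqrt (p * q) * (e * b * d * f)"
    proof -
      have "t * (e * b * d * f) \<le> sqrt (p * q) * (e * b * d * f)"
        using sq by (intro mult_right_mono) (auto simp: ab)
      moreover have "t * Re (x$3 * cnj (x$2) * cnj (y$2) * y$3) \<ge> t * - (e * b * d * f)"
        using assms re[of "x$3 * cnj (x$2) * cnj (y$2) * y$3"]
        by (intro mult_left_mono) (auto simp: ab norm_mult)
      ultimately show ?thesis by simp
    qed
    have "0 \<le> (sqrt p * (a * c + b * d) - sqrt q * (e * f))\<^sup>2 + p * (a * d - b * c)\<^sup>2"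
      using assms by simp
    also have "\<dots> = (sqrt p)\<^sup>2 * (a * c + b * d)\<^sup>2 + (sqrt q)\<^sup>2 * (e * f)\<^sup>2 + p * (a * d - b * c)\<^sup>2
        - 2 * (sqrt p * sqrt q) * ((a * c + b * d) * (e * f))"
      by (simp add: power2_eq_square algebra_simps)
    also have "\<dots> = p * (a\<^sup>2 + b\<^sup>2) * (c\<^sup>2 + d\<^sup>2) + q * e\<^sup>2 * f\<^sup>2
       - 2 * sqrt (p * q) * (a * e * c * f) - 2 * sqrt (p * q) * (e * b * d * f)"
      using assms by (simp add: real_sqrt_mult) (simp add: power2_eq_square algebra_simps)
    finally show "quad (Psi p q r t (ketbra x)) y \<in> \<real>\<^sub>\<ge>\<^sub>0"
      using 1 2 unfolding quad_Psi_ketbra ab[symmetric] by (simp add: complex_nonneg_Reals_iff)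
  qed
  then have "psd (Psi p q r t X)" if X: "psd X" for X
  proof -
    obtain n :: nat and v where "X = (\<Sum>i<n. ketbra (v i))"
      using psd_eq_sum_ketbra[OF X] by blast
    then show ?thesis
      by (simp add: mscale_linear_sum[OF linear_Psi] psd_sum \<open>\<And>x. psd (Psi p q r t (ketbra x))\<close>)
  qed
  then show ?thesis by (simp add: positive_map_def linear_Psi)
qed

text \<open>The off-diagonal coefficients are seen one at a time on inputs supported on two coordinates;
  the vectors at which the outputs are tested minimize the resulting forms in two variables for
  the given last coordinate.\<close>

lemma positive_map_PsiD:
  assumes "p > 0" "positive_map (Psi p q r t)"
  shows "r\<^sup>2 \<le> p * q" "t\<^sup>2 \<le> p * q"
proof -
  have q: "quad (Psi p q r t (ketbra x)) y \<in> \<real>\<^sub>\<ge>\<^sub>0" for x y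
    using assms(2) psd_ketbra unfolding positive_map_def psd_iff_quad by blast
  have "0 \<le> p * r\<^sup>2 + q * p\<^sup>2 - 2 * r * (r * p)"
    using q[of "vector [1, 0, 1]" "vector [- of_real r, 0, of_real p]"]
    unfolding quad_Psi_ketbra by (simp add: complex_nonneg_Reals_iff)
  then have "0 \<le> p * (p * q - r\<^sup>2)" by (simp add: power2_eq_square algebra_simps)
  then show "r\<^sup>2 \<le> p * q" using assms(1) by (simp add: zero_le_mult_iff)
  have "0 \<le> p * t\<^sup>2 + q * p\<^sup>2 - 2 * t * (t * p)"
    using q[of "vector [0, 1, 1]" "vector [0, - of_real t, of_real p]"]
    unfolding quad_Psi_ketbra by (simp add: complex_nonneg_Reals_iff)
  then have "0 \<le> p * (p * q - t\<^sup>2)" by (simp add: power2_eq_square algebra_simps)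
  then show "t\<^sup>2 \<le> p * q" using assms(1) by (simp add: zero_le_mult_iff)
qed

section \<open>The matrices and their partial transposes\<close>

lemma pairing_Psi: "pairing (Psi p q r t) \<rho> =
  of_real p * (\<rho>$(1,1)$(1,1) + \<rho>$(1,2)$(1,2) + \<rho>$(2,1)$(2,1) + \<rho>$(2,2)$(2,2)) + of_real q * \<rho>$(3,3)$(3,3)
  + of_real r * (\<rho>$(1,1)$(3,3) + \<rho>$(3,3)$(1,1)) + of_real t * (\<rho>$(2,3)$(3,2) + \<rho>$(3,2)$(2,3))"
  by (simp add: pairing_def sum_UNIV_3x3 sum_3 Psi_def matrix_unit_def algebra_simps)

lemma fvec_nth: "fvec i j $ u = (if u = (i, j) then 1 else 0)"
  by (cases u) (auto simp: fvec_def vtensor_def axis_def)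

lemma rho_nth:
  "rho p r t $ u $ v = (let a = of_real (r / p); b = of_real (t / p) in
     if u = (1,1) \<and> v = (1,1) then a\<^sup>2
     else if u = (1,1) \<and> v = (3,3) \<or> u = (3,3) \<and> v = (1,1) then - a
     else if u = (3,3) \<and> v = (3,3) then 1
     else if u = v \<and> u \<in> {(2,3), (3,2)} then b
     else if u = (2,3) \<and> v = (3,2) \<or> u = (3,2) \<and> v = (2,3) then - b
     else if u = v \<and> u \<in> {(1,3), (3,1)} then a
     else if u = (2,2) \<and> v = (2,2) then b\<^sup>2
     else 0)"
  by (auto simp: rho_def Let_def ketbra_def fvec_nth scaleR_conv_of_real[where 'a = complex] power2_eq_square)

text \<open>Up to exchanging the basis indices \<open>1\<close> and \<open>2\<close> in both factors, partial transposition
  exchanges the roles of \<open>r\<close> and \<open>t\<close>. In particular the partial transpose is again a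
  nonnegative combination of \<open>ketbra v\<close> with \<open>v\<close> of Schmidt rank at most two,
  which gives the PPT property and the upper bound on its Schmidt number.\<close>

lemma partial_transpose_rho:
  "partial_transpose (rho p r t) =
    ketbra ((t / p) *\<^sub>R fvec 2 2 - fvec 3 3) + (r / p) *\<^sub>R ketbra (fvec 1 3 - fvec 3 1)
    + (t / p) *\<^sub>R (ketbra (fvec 2 3) + ketbra (fvec 3 2)) + (r / p)\<^sup>2 *\<^sub>R ketbra (fvec 1 1)"
  unfolding vec_eq_iff forall_3x3 forall_3
  by (simp add: partial_transpose_def rho_nth Let_def ketbra_def fvec_nth
      scaleR_conv_of_real[where 'a = complex] power2_eq_square)

lemma schmidt_rank_fvec: "schmidt_rank (fvec i j) \<le> 2"
  using schmidt_rank_vtensor[of "axis i 1" "axis j 1"] unfolding fvec_def by linarith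

lemma schmidt_rank_fvec_diff: "schmidt_rank (c *\<^sub>R fvec i j - fvec k l) \<le> 2"
proof -
  have "c *\<^sub>R fvec i j - fvec k l = vtensor (of_real c *s axis i 1) (axis j 1) + vtensor (- axis k 1) (axis l 1)"
    by (simp add: fvec_def vtensor_def vec_eq_iff scaleR_conv_of_real[where 'a = complex])
  then show ?thesis by (simp add: schmidt_rank_vtensor_add)
qed

lemma schmidt_bounded_imp_psd: "schmidt_bounded k \<rho> \<Longrightarrow> psd \<rho>"
  by (auto simp: schmidt_bounded_def intro: psd_sum psd_ketbra)

lemma schmidt_bounded_rho:
  assumes "p > 0" "r \<ge> 0" "t \<ge> 0"
  shows "schmidt_bounded 2 (rho p r t)" "schmidt_bounded 2 (partial_transpose (rho p r t))"
  using assms schmidt_rank_fvec_diff[of 1] schmidt_rank_fvec_diff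
  unfolding partial_transpose_rho unfolding rho_def Let_def
  by (auto intro!: schmidt_bounded_add schmidt_bounded_scaleR schmidt_bounded_ketbra schmidt_rank_fvec)

text \<open>The coefficients of \<open>rho\<close> minimize this quadratic polynomial: with \<open>\<alpha> = r / p\<close> and
  \<open>\<beta> = t / p\<close> the pairing is \<open>p (\<alpha>\<^sup>2 + \<beta>\<^sup>2) + q - 2 r \<alpha> - 2 t \<beta>\<close>. It is negative precisely when
  \<open>r\<^sup>2 + t\<^sup>2 > p q\<close>.\<close>

lemma pairing_Psi_rho:
  assumes "p > 0"
  shows "pairing (Psi p q r t) (rho p r t) = of_real (q - (r\<^sup>2 + t\<^sup>2) / p)"
  using assms by (simp add: pairing_Psi rho_nth Let_def complex_eq_iff) (simp add: field_simps power2_eq_square)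

lemma trace_rho: "trace (rho p r t) = of_real ((r / p)\<^sup>2 + 2 * (r / p) + 2 * (t / p) + (t / p)\<^sup>2 + 1)"
  by (simp add: trace_def sum_UNIV_3x3 sum_3 rho_nth Let_def)

lemma rho_hat_eq_scaleR:
  assumes "p > 0" "r \<ge> 0" "t \<ge> 0"
  obtains c where "c > 0" "rho_hat p r t = c *\<^sub>R rho p r t" "of_real c * trace (rho p r t) = 1"
proof
  let ?T = "(r / p)\<^sup>2 + 2 * (r / p) + 2 * (t / p) + (t / p)\<^sup>2 + 1"
  have "?T > 0" using assms by (intro add_nonneg_pos add_nonneg_nonneg) auto
  then show "1 / ?T > 0" by simp
  have "1 / ?T * ?T = 1" using \<open>?T > 0\<close> by simp
  then show "of_real (1 / ?T) * trace (rho p r t) = 1"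
    unfolding trace_rho by (metis of_real_mult of_real_1)
  show "rho_hat p r t = (1 / ?T) *\<^sub>R rho p r t"
    unfolding rho_hat_def trace_rho
    by (simp add: mscale_def vec_eq_iff scaleR_conv_of_real[where 'a = complex])
qed

lemma partial_transpose_nth: "partial_transpose \<rho> $ u $ v = \<rho> $ (fst u, snd v) $ (fst v, snd u)"
  by (simp add: partial_transpose_def)

text \<open>Among the nonzero rows only the one at \<open>(3,3)\<close> and one of the pair \<open>(2,3)\<close>, \<open>(3,2)\<close> are
  redundant; the remaining five are pivot rows. For the partial transpose the pair is
  \<open>(1,3)\<close>, \<open>(3,1)\<close> instead.\<close>

lemma rank_rho:
  assumes "p > 0" "r > 0" "t > 0" "c \<noteq> 0"
  shows "rank (c *\<^sub>R rho p r t) = 5"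
proof -
  define S where "S = ({(1,1), (2,2), (1,3), (3,1), (2,3)} :: (3 \<times> 3) set)"
  define A where "A = c *\<^sub>R rho p r t"
  note entries = A_def rho_nth Let_def scaleR_conv_of_real[where 'a = complex]
  have nz: "complex_of_real c \<noteq> 0" "complex_of_real r \<noteq> 0" "complex_of_real t \<noteq> 0" "complex_of_real p \<noteq> 0"
    using assms by auto
  have zero: "A $ (1,2) = 0 *s A $ (1,1)" "A $ (2,1) = 0 *s A $ (1,1)"
    unfolding vec_eq_iff forall_3x3 forall_3 by (simp_all add: entries)
  have multiple: "A $ (3,3) = - of_real (p / r) *s A $ (1,1)" "A $ (3,2) = (-1) *s A $ (2,3)"
    unfolding vec_eq_iff forall_3x3 forall_3 using nz by (simp_all add: entries power2_eq_square)
  have S: "(1,1) \<in> S" "(2,3) \<in> S"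
    by (simp_all add: S_def)
  have cover: "\<forall>u. u \<in> S \<or> u = (3,3) \<or> u = (3,2) \<or> u = (1,2) \<or> u = (2,1)"
    by (simp add: S_def forall_3x3 forall_3)
  have "rank A = card S"
  proof (rule rank_eq_card_pivots)
    have "\<forall>u\<in>S. A $ u $ u \<noteq> 0"
      using nz unfolding S_def ball_simps by (simp add: entries)
    then show "u \<in> S \<Longrightarrow> A $ u $ u \<noteq> 0" for u by blast
    have "\<forall>u\<in>S. \<forall>v\<in>S. u \<noteq> v \<longrightarrow> A $ u $ v = 0"
      unfolding S_def ball_simps by (simp add: entries)
    then show "u \<in> S \<Longrightarrow> v \<in> S \<Longrightarrow> u \<noteq> v \<Longrightarrow> A $ u $ v = 0" for u v by blast
    fix u assume "u \<notin> S"
    then consider "u = (3,3)" | "u = (3,2)" | "u = (1,2)" | "u = (2,1)"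
      using cover by blast
    then show "\<exists>v\<in>S. \<exists>d. A $ u = d *s A $ v"
    proof cases
      case 1 then show ?thesis using multiple(1) S(1) by metis
    next
      case 2 then show ?thesis using multiple(2) S(2) by metis
    next
      case 3 then show ?thesis using zero(1) S(1) by metis
    next
      case 4 then show ?thesis using zero(2) S(1) by metis
    qed
  qed
  then show ?thesis
    by (simp add: S_def A_def)
qed

lemma rank_partial_transpose_rho:
  assumes "p > 0" "r > 0" "t > 0" "c \<noteq> 0"
  shows "rank (partial_transpose (c *\<^sub>R rho p r t)) = 5"
proof -
  define S where "S = ({(1,1), (2,2), (1,3), (3,2), (2,3)} :: (3 \<times> 3) set)"
  define A where "A = partial_transpose (c *\<^sub>R rho p r t)"
  note entries = A_def rho_nth Let_def partial_transpose_nth scaleR_conv_of_real[where 'a = complex]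
  have nz: "complex_of_real c \<noteq> 0" "complex_of_real r \<noteq> 0" "complex_of_real t \<noteq> 0" "complex_of_real p \<noteq> 0"
    using assms by auto
  have zero: "A $ (1,2) = 0 *s A $ (1,1)" "A $ (2,1) = 0 *s A $ (1,1)"
    unfolding vec_eq_iff forall_3x3 forall_3 by (simp_all add: entries)
  have multiple: "A $ (3,3) = - of_real (p / t) *s A $ (2,2)" "A $ (3,1) = (-1) *s A $ (1,3)"
    unfolding vec_eq_iff forall_3x3 forall_3 using nz by (simp_all add: entries power2_eq_square)
  have S: "(1,1) \<in> S" "(2,2) \<in> S" "(1,3) \<in> S"
    by (simp_all add: S_def)
  have cover: "\<forall>u. u \<in> S \<or> u = (3,3) \<or> u = (3,1) \<or> u = (1,2) \<or> u = (2,1)"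
    by (simp add: S_def forall_3x3 forall_3)
  have "rank A = card S"
  proof (rule rank_eq_card_pivots)
    have "\<forall>u\<in>S. A $ u $ u \<noteq> 0"
      using nz unfolding S_def ball_simps by (simp add: entries)
    then show "u \<in> S \<Longrightarrow> A $ u $ u \<noteq> 0" for u by blast
    have "\<forall>u\<in>S. \<forall>v\<in>S. u \<noteq> v \<longrightarrow> A $ u $ v = 0"
      unfolding S_def ball_simps by (simp add: entries)
    then show "u \<in> S \<Longrightarrow> v \<in> S \<Longrightarrow> u \<noteq> v \<Longrightarrow> A $ u $ v = 0" for u v by blast
    fix u assume "u \<notin> S"
    then consider "u = (3,3)" | "u = (3,1)" | "u = (1,2)" | "u = (2,1)"
      using cover by blast
    then show "\<exists>v\<in>S. \<exists>d. A $ u = d *s A $ v"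
    proof cases
      case 1 then show ?thesis using multiple(1) S(2) by metis
    next
      case 2 then show ?thesis using multiple(2) S(3) by metis
    next
      case 3 then show ?thesis using zero(1) S(1) by metis
    next
      case 4 then show ?thesis using zero(2) S(1) by metis
    qed
  qed
  then show ?thesis
    by (simp add: S_def A_def)
qed

section \<open>Entanglement, Schmidt numbers and atomicity\<close>

text \<open>A negative pairing with a positive map excludes any decomposition into product vectors, for the
  state itself and, since partial transposition preserves such decompositions, for its partial
  transpose. Both bounds on the Schmidt numbers then meet at two.\<close>

lemma ppt_entangled_rho_hat:
  assumes "p > 0" "r > 0" "t > 0" "positive_map (Psi p q r t)" "r\<^sup>2 + t\<^sup>2 > p * q"
  shows "ppt_state (rho_hat p r t)" "entangled_state (rho_hat p r t)"
    "rank (rho_hat p r t) = 5" "rank (partial_transpose (rho_hat p r t)) = 5"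
    "schmidt_number (rho_hat p r t) = 2" "schmidt_number (partial_transpose (rho_hat p r t)) = 2"
proof -
  have rt: "r \<ge> 0" "t \<ge> 0" using assms by auto
  obtain c where c: "c > 0" "rho_hat p r t = c *\<^sub>R rho p r t" "of_real c * trace (rho p r t) = 1"
    using rho_hat_eq_scaleR[OF assms(1) rt] .
  have sb: "schmidt_bounded 2 (rho_hat p r t)" "schmidt_bounded 2 (partial_transpose (rho_hat p r t))"
    unfolding c(2) partial_transpose_scaleR
    using c(1) schmidt_bounded_rho[OF assms(1) rt] by (auto intro: schmidt_bounded_scaleR)
  have "Re (pairing (Psi p q r t) (rho_hat p r t)) = c * (q - (r\<^sup>2 + t\<^sup>2) / p)"
    unfolding c(2) pairing_scaleR_right pairing_Psi_rho[OF assms(1)] by simp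
  also have "\<dots> < 0"
    using c(1) assms(1,5) by (intro mult_pos_neg) (simp_all add: field_simps)
  finally have nsb: "\<not> schmidt_bounded 1 (rho_hat p r t)"
    using positive_map_pairing_nonneg[OF assms(4), of "rho_hat p r t"] by (auto simp: complex_nonneg_Reals_iff)
  then have nsb': "\<not> schmidt_bounded 1 (partial_transpose (rho_hat p r t))"
    using schmidt_bounded_partial_transpose[of "partial_transpose (rho_hat p r t)"] by auto
  have "trace (rho_hat p r t) = of_real c * trace (rho p r t)"
    unfolding c(2) by (simp add: trace_def sum_distrib_left scaleR_conv_of_real[where 'a = complex])
  then have state: "is_state (rho_hat p r t)"
    using c(3) sb(1) by (simp add: is_state_def schmidt_bounded_imp_psd)
  then show "ppt_state (rho_hat p r t)"
    using sb(2) by (simp add: ppt_state_def schmidt_bounded_imp_psd)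
  show "entangled_state (rho_hat p r t)"
    using state nsb separable_imp_schmidt_bounded by (auto simp: entangled_state_def)
  show "rank (rho_hat p r t) = 5" "rank (partial_transpose (rho_hat p r t)) = 5"
    unfolding c(2) using rank_rho[OF assms(1-3)] rank_partial_transpose_rho[OF assms(1-3)] c(1) by auto
  show "schmidt_number (rho_hat p r t) = 2" "schmidt_number (partial_transpose (rho_hat p r t)) = 2"
    by (intro schmidt_number_eq_2 sb nsb nsb')+
qed

text \<open>In a decomposition into a 2-positive and a 2-copositive map, the first summand would pair
  nonnegatively with \<open>rho\<close> and the second with its partial transpose, because both matrices
  have Schmidt number at most two; but the total pairing is negative.\<close>

lemma atomic_map_Psi:
  assumes "p > 0" "r \<ge> 0" "t \<ge> 0" "positive_map (Psi p q r t)" "r\<^sup>2 + t\<^sup>2 > p * q"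
  shows "atomic_map (Psi p q r t)"
  unfolding atomic_map_def
proof (intro conjI notI assms(4))
  assume "\<exists>\<Phi>\<^sub>1 \<Phi>\<^sub>2. k_positive TYPE(2) \<Phi>\<^sub>1 \<and> k_copositive TYPE(2) \<Phi>\<^sub>2 \<and>
      (\<forall>X. Psi p q r t X = \<Phi>\<^sub>1 X + \<Phi>\<^sub>2 X)"
  then obtain \<Phi>\<^sub>1 \<Phi>\<^sub>2 where \<Phi>: "k_positive TYPE(2) \<Phi>\<^sub>1" "k_positive TYPE(2) (transpose \<circ> \<Phi>\<^sub>2)"
    and sum: "Psi p q r t = (\<lambda>X. \<Phi>\<^sub>1 X + \<Phi>\<^sub>2 X)"
    by (auto simp: k_copositive_def)
  have "pairing \<Phi>\<^sub>1 (rho p r t) \<in> \<real>\<^sub>\<ge>\<^sub>0"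
    using pairing_nonneg[OF \<Phi>(1)] schmidt_bounded_rho(1)[OF assms(1-3)] by simp
  moreover have "pairing \<Phi>\<^sub>2 (rho p r t) \<in> \<real>\<^sub>\<ge>\<^sub>0"
    using pairing_nonneg[OF \<Phi>(2)] schmidt_bounded_rho(2)[OF assms(1-3)]
    by (simp flip: pairing_partial_transpose[of \<Phi>\<^sub>2])
  ultimately have "pairing (Psi p q r t) (rho p r t) \<in> \<real>\<^sub>\<ge>\<^sub>0"
    unfolding sum pairing_add_left by simp
  then have "q - (r\<^sup>2 + t\<^sup>2) / p \<ge> 0"
    unfolding pairing_Psi_rho[OF assms(1)] by (simp add: complex_nonneg_Reals_iff)
  then show False using assms(1,5) by (simp add: field_simps)
qed

lemma rho_hat_Rats:
  assumes "p \<in> \<rat>" "r \<in> \<rat>" "t \<in> \<rat>"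
  shows "rho_hat p r t $ u $ v \<in> \<rat>"
proof -
  have "rho p r t $ u $ v \<in> \<rat>"
    using assms unfolding rho_nth Let_def by (auto simp del: of_real_divide)
  moreover have "trace (rho p r t) \<in> \<rat>"
    using assms unfolding trace_rho Rats_complex_of_real_iff by simp
  ultimately show ?thesis
    by (simp add: rho_hat_def mscale_def)
qed

theorem corollary3p8:
  fixes p q r t :: real
  assumes "p > 0" and "q > 0" and "r \<ge> 0" and "t \<ge> 0"
  shows
    "(positive_map (Psi p q r t) \<and> r\<^sup>2 + t\<^sup>2 > p * q \<longrightarrow>
        r > 0 \<and> t > 0 \<and>
        ppt_state (rho_hat p r t) \<and> entangled_state (rho_hat p r t) \<and>
        rank (rho_hat p r t) = 5 \<and> rank (partial_transpose (rho_hat p r t)) = 5 \<and>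
        schmidt_number (rho_hat p r t) = 2 \<and>
        schmidt_number (partial_transpose (rho_hat p r t)) = 2 \<and>
        (p \<in> \<rat> \<and> r \<in> \<rat> \<and> t \<in> \<rat> \<longrightarrow> (\<forall>u v. rho_hat p r t $ u $ v \<in> \<rat>))) \<and>
     (r\<^sup>2 \<le> p * q \<and> t\<^sup>2 \<le> p * q \<and> r\<^sup>2 + t\<^sup>2 > p * q \<longrightarrow>
        atomic_map (Psi p q r t) \<and>
        ppt_state (rho_hat p r t) \<and> entangled_state (rho_hat p r t) \<and>
        birank (rho_hat p r t) = (5, 5) \<and>
        schmidt_number (rho_hat p r t) = 2 \<and>
        schmidt_number (partial_transpose (rho_hat p r t)) = 2)"
proof -
  have pos: "r > 0" "t > 0" if "r\<^sup>2 \<le> p * q" "t\<^sup>2 \<le> p * q" "r\<^sup>2 + t\<^sup>2 > p * q"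
    using that assms(3,4) by (auto simp: less_le)
  show ?thesis
  proof (rule conjI; intro impI; elim conjE)
    assume psi: "positive_map (Psi p q r t)" and gt: "r\<^sup>2 + t\<^sup>2 > p * q"
    have "r > 0" "t > 0"
      using pos positive_map_PsiD[OF assms(1) psi] gt by auto
    then show "r > 0 \<and> t > 0 \<and>
        ppt_state (rho_hat p r t) \<and> entangled_state (rho_hat p r t) \<and>
        rank (rho_hat p r t) = 5 \<and> rank (partial_transpose (rho_hat p r t)) = 5 \<and>
        schmidt_number (rho_hat p r t) = 2 \<and>
        schmidt_number (partial_transpose (rho_hat p r t)) = 2 \<and>
        (p \<in> \<rat> \<and> r \<in> \<rat> \<and> t \<in> \<rat> \<longrightarrow> (\<forall>u v. rho_hat p r t $ u $ v \<in> \<rat>))"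
      using ppt_entangled_rho_hat[OF assms(1) _ _ psi gt] rho_hat_Rats by blast
  next
    assume le: "r\<^sup>2 \<le> p * q" "t\<^sup>2 \<le> p * q" and gt: "r\<^sup>2 + t\<^sup>2 > p * q"
    have psi: "positive_map (Psi p q r t)"
      by (rule positive_map_PsiI[OF assms le])
    show "atomic_map (Psi p q r t) \<and>
        ppt_state (rho_hat p r t) \<and> entangled_state (rho_hat p r t) \<and>
        birank (rho_hat p r t) = (5, 5) \<and>
        schmidt_number (rho_hat p r t) = 2 \<and>
        schmidt_number (partial_transpose (rho_hat p r t)) = 2"
      using ppt_entangled_rho_hat[OF assms(1) pos[OF le gt] psi gt]
        atomic_map_Psi[OF assms(1,3,4) psi gt] by (simp add: birank_def)
  qed
qed

end
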